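(* Let $G$ be a topological group which contains an injective convergent sequence $(a_n)_{n\in\omega}$ (that is, the elements $a_n$ are pairwise distinct and the sequence converges to some element of $G$). Then $G$ is box $\omega$-resolvable: there exist a dense subset $B$ of $G$ and a subset $A$ of $G$ with $|A|=\omega$ such that the subsets $aB$, $a\in A$, are pairwise disjoint and $G=AB$.
   Context: For subsets $A,B$ of a group $G$, $AB=\{ab: a\in A, b\in B\}$ and $aB=\{ab: b\in B\}$. A topological group $G$ is called box $\kappa$-resolvable, for a cardinal $\kappa$, if there exist a subset $B$ dense in $G$ and a subset $A\subseteq G$ with $|A|=\kappa$ such that $aB\cap a'B=\emptyset$ for all distinct $a,a'\in A$ and $G=AB$. Here $\omega$ denotes the first infinite cardinal. *)

theory Defs
  imports "HOL-Analysis.Analysis" "HOL-Library.Set_Algebras" "HOL-Library.Disjoint_Sets"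
begin

text \<open>
  The type class \<open>topological_group_add\<close> is the library's notion of a topological group. Despite its
  additive notation it assumes neither commutativity nor any separation axiom, so
  \<open>a +o B\<close> is the left translate usually written $aB$ and \<open>A + B\<close> is the product $AB$, in this order.

  A cardinal is represented, as usual in the library, by a cardinal order \<open>\<kappa>\<close>; the cardinality
  condition on \<open>A\<close> is spelled out with \<open>ordIso\<close> because the infix syntax for it clashes with
  an input abbreviation of \<open>Set_Algebras\<close>. The cardinal of the natural numbers is \<open>natLeq\<close>.
\<close>

definition box_resolvable :: "'a::topological_group_add itself \<Rightarrow> 'k rel \<Rightarrow> bool" where
  "box_resolvable G \<kappa> \<longleftrightarrow>
     (\<exists>(B :: 'a set) (A :: 'a set).
        closure B = UNIV \<and>
        (card_of A, \<kappa>) \<in> ordIso \<and>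
        disjoint_family_on (\<lambda>a. a +o B) A \<and>
        A + B = UNIV)"

end

theory Submission
  imports Defs
begin

text \<open>
  Write \<open>c\<^sub>n = a\<^sub>n - lim a\<close>, an injective sequence tending to \<open>0\<close>, and let \<open>H\<close> be the countable
  subgroup generated by it. It is enough to factorize \<open>H\<close>: if \<open>A\<close> is infinite, every element of
  \<open>H\<close> is uniquely \<open>a + b\<close> with \<open>a \<in> A\<close>, \<open>b \<in> B\<close>, and for each \<open>h \<in> H\<close> the set \<open>B\<close> contains
  \<open>h + c\<^sub>n\<close> for infinitely many \<open>n\<close>, then \<open>B\<close> accumulates at every point of \<open>H\<close>; adding a
  transversal \<open>T\<close> of the right cosets of \<open>H\<close> on the right gives a dense set \<open>B + T\<close> whose translates
  by \<open>A\<close> partition the group. Countability of \<open>A\<close> comes for free from \<open>A \<subseteq> H\<close>.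

  The factorization of \<open>H\<close> is a union of finite partial ones (\<open>ex_factorization\<close>). Putting some
  \<open>h + c\<^sub>n\<close> into \<open>B\<close>, or a new element into \<open>A\<close>, only has to avoid finitely many elements. To make an
  uncovered \<open>g\<close> a product one puts a new \<open>y\<close> into \<open>A\<close> and \<open>- y + g\<close> into \<open>B\<close>. The one condition on
  \<open>y\<close> that may exclude infinitely many elements is \<open>y + b \<noteq> a + (- y + g)\<close>, that is
  \<open>y + u + y \<noteq> a\<close> with \<open>u = b - g\<close>; since \<open>g\<close> is uncovered, \<open>a + u \<noteq> 0\<close>. In groups with many
  elements of order four such equations can exhaust all of \<open>H\<close>, so the elements of \<open>A\<close> are chosen from a
  well-selected infinite set \<open>Y \<subseteq> H\<close>, called evasive below, in which finitely many of these
  equations never exhaust a cofinite subset.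

  That evasive sets exist (\<open>ex_evasive\<close>) is the group-theoretic core. If \<open>H\<close> is not
  evasive in itself, finitely many equations \<open>y + u + y = a\<close> cover almost all of \<open>H\<close>. Any two
  solutions of one equation differ by an element which a translate of either solution inverts, and the
  elements inverting a given \<open>v\<close> lie in one coset of the centralizer of \<open>v\<close>. A covering of \<open>H\<close> by finitely many
  cosets needs a subgroup of finite index (B. H. Neumann), so some \<open>v\<close> has a
  centralizer of finite index; choosing the translates with care shows that infinitely many do. Among
  such elements one finds an infinite commuting set, and for commuting elements
  \<open>y + u + y = a\<close> just prescribes \<open>y + y\<close>. Either infinitely many doubles are distinct, and each
  equation has at most one solution, or one can shift to elements with \<open>y + y = 0\<close>, where the equation
  would force \<open>a + u = 0\<close>.
\<close>

section \<open>Subgroups of finite index\<close>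

lemmas group_normalize =
  diff_conv_add_uminus add.assoc minus_add minus_minus minus_add_cancel add_minus_cancel
  left_minus right_minus add_0_left add_0_right

definition is_subgroup :: "'a::group_add set \<Rightarrow> bool" where
  "is_subgroup H \<longleftrightarrow> 0 \<in> H \<and> (\<forall>x\<in>H. \<forall>y\<in>H. x - y \<in> H)"

lemma is_subgroup_zero: "is_subgroup H \<Longrightarrow> 0 \<in> H"
  by (simp add: is_subgroup_def)

lemma is_subgroup_diff: "is_subgroup H \<Longrightarrow> x \<in> H \<Longrightarrow> y \<in> H \<Longrightarrow> x - y \<in> H"
  by (simp add: is_subgroup_def)

lemma is_subgroup_minus: "is_subgroup H \<Longrightarrow> x \<in> H \<Longrightarrow> - x \<in> H"
  using is_subgroup_diff[of H 0 x] by (simp add: is_subgroup_zero)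

lemma is_subgroup_add: "is_subgroup H \<Longrightarrow> x \<in> H \<Longrightarrow> y \<in> H \<Longrightarrow> x + y \<in> H"
  using is_subgroup_diff[of H x "- y"] by (simp add: is_subgroup_minus)

lemmas is_subgroup_closed =
  is_subgroup_zero is_subgroup_diff is_subgroup_minus is_subgroup_add

lemma is_subgroup_Int: "is_subgroup C \<Longrightarrow> is_subgroup D \<Longrightarrow> is_subgroup (C \<inter> D)"
  by (simp add: is_subgroup_def)

text \<open>
  The subgroup generated by \<open>S\<close> consists of the values of finite words in \<open>S\<close> and \<open>- S\<close>, and there
  are only countably many words.
\<close>
lemma countable_subgroup_hull:
  fixes S :: "'a::group_add set"
  assumes "countable S"
  obtains H where "is_subgroup H" "countable H" "S \<subseteq> H"
proof
  let ?H = "sum_list ` lists (S \<union> uminus ` S)"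
  have neg: "- sum_list xs \<in> ?H" if "xs \<in> lists (S \<union> uminus ` S)" for xs
  proof -
    have "- sum_list xs = sum_list (rev (map uminus xs))"
      by (induction xs) (simp_all add: minus_add)
    moreover have "rev (map uminus xs) \<in> lists (S \<union> uminus ` S)"
      using that by (auto simp: in_lists_conv_set)
    ultimately show ?thesis
      by blast
  qed
  have add: "x + y \<in> ?H" if xy: "x \<in> ?H" "y \<in> ?H" for x y
  proof -
    obtain xs ys where "xs \<in> lists (S \<union> uminus ` S)" "x = sum_list xs"
        "ys \<in> lists (S \<union> uminus ` S)" "y = sum_list ys"
      using xy by (elim imageE)
    then show ?thesis
      by (intro image_eqI[of _ _ "xs @ ys"]) simp_all
  qed
  have "0 \<in> ?H"
    by (rule image_eqI[of _ _ "[]"]) simp_all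
  moreover have "x - y \<in> ?H" if "x \<in> ?H" "y \<in> ?H" for x y
    using add[OF that(1), of "- y"] neg that(2) by (metis add_uminus_conv_diff imageE)
  ultimately show "is_subgroup ?H"
    by (simp add: is_subgroup_def)
  show "countable ?H"
    using assms by (intro countable_image countable_lists) auto
  show "S \<subseteq> ?H"
  proof
    fix x assume "x \<in> S"
    then show "x \<in> ?H"
      by (intro image_eqI[of _ _ "[x]"]) auto
  qed
qed

text \<open>
  Stated through a finite covering by right cosets, so that no quotient is needed.
\<close>
definition finite_index :: "'a::group_add set \<Rightarrow> 'a set \<Rightarrow> bool" where
  "finite_index H C \<longleftrightarrow> (\<exists>X. finite X \<and> H \<subseteq> C + X)"

lemma finite_index_mono: "finite_index H C \<Longrightarrow> C \<subseteq> D \<Longrightarrow> finite_index H D"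
  unfolding finite_index_def by (metis order_trans set_plus_mono2 subset_refl)

lemma finite_index_refl: "finite_index H H"
  unfolding finite_index_def
proof (intro exI conjI subsetI)
  show "h \<in> H + {0}" if "h \<in> H" for h
    using set_plus_intro[OF that, of 0 "{0}"] by simp
qed simp

text \<open>
  Each coset of \<open>C\<close> meets each coset of \<open>D\<close> in at most one coset of \<open>C \<inter> D\<close>, so one point from each
  nonempty intersection suffices.
\<close>
lemma finite_index_Int:
  assumes C: "is_subgroup C" "finite_index H C" and D: "is_subgroup D" "finite_index H D"
  shows "finite_index H (C \<inter> D)"
proof -
  obtain X X' where X: "finite X" "H \<subseteq> C + X" and X': "finite X'" "H \<subseteq> D + X'"
    using assms unfolding finite_index_def by auto
  define P where "P = (\<lambda>(x, x') h. h - x \<in> C \<and> h - x' \<in> D)"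
  define r where "r p = (SOME h. P p h)" for p
  have "h \<in> (C \<inter> D) + r ` (X \<times> X')" if h: "h \<in> H" for h
  proof -
    obtain c x where "h = c + x" "c \<in> C" "x \<in> X"
      using subsetD[OF X(2) h] by (rule set_plus_elim)
    moreover obtain d x' where "h = d + x'" "d \<in> D" "x' \<in> X'"
      using subsetD[OF X'(2) h] by (rule set_plus_elim)
    ultimately have p: "(x, x') \<in> X \<times> X'" and h: "P (x, x') h"
      unfolding P_def by (auto simp: eq_diff_eq dest: sym)
    have "P (x, x') (r (x, x'))"
      unfolding r_def using h by (rule someI)
    with h have "(h - x) - (r (x, x') - x) \<in> C" "(h - x') - (r (x, x') - x') \<in> D"
      using C D by (auto simp: P_def intro!: is_subgroup_closed)
    then have "h - r (x, x') \<in> C \<inter> D"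
      by (simp add: diff_diff_eq2)
    then show ?thesis
      using p by (metis diff_add_cancel imageI set_plus_intro)
  qed
  then show ?thesis
    unfolding finite_index_def using X X' by (intro exI[of _ "r ` (X \<times> X')"]) auto
qed

text \<open>
  B. H. Neumann's lemma. Remove the subgroups one at a time: as \<open>C\<close> has infinite index, some coset
  \<open>C + g\<close> is not among the finitely many cosets used, hence is covered by cosets of the other
  subgroups. Translating this covering on the right covers every coset of \<open>C\<close> in the same way.
\<close>
lemma not_covered_by_cosets_of_infinite_index:
  assumes "finite \<C>" and "finite X"
    and "\<And>C. C \<in> \<C> \<Longrightarrow> is_subgroup C \<and> C \<subseteq> H \<and> \<not> finite_index H C"
    and H: "is_subgroup H"
  shows "\<not> H \<subseteq> (\<Union>C\<in>\<C>. C + X)"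
  using assms(1,2,3)
proof (induction \<C> arbitrary: X rule: finite_induct)
  case empty
  then show ?case
    using is_subgroup_zero[OF H] by auto
next
  case (insert C \<C>)
  show ?case
  proof
    assume cov: "H \<subseteq> (\<Union>D\<in>insert C \<C>. D + X)"
    have C: "is_subgroup C" "C \<subseteq> H" "\<not> finite_index H C"
      using insert.prems(2) by auto
    then obtain g where g: "g \<in> H" "g \<notin> C + X"
      using insert.prems(1) unfolding finite_index_def by blast
    have coset: "c + g \<in> (\<Union>D\<in>\<C>. D + X)" if "c \<in> C" for c
    proof -
      have "c + g \<in> H"
        using that C g H by (auto intro: is_subgroup_closed)
      moreover have "c + g \<notin> C + X"
      proof
        assume "c + g \<in> C + X"
        then obtain c' x where "c + g = c' + x" "c' \<in> C" "x \<in> X"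
          by (auto elim!: set_plus_elim)
        then have "g = (- c + c') + x"
          by (metis add.assoc minus_add_cancel)
        then show False
          using g C that \<open>c' \<in> C\<close> \<open>x \<in> X\<close> by (metis is_subgroup_add is_subgroup_minus set_plus_intro)
      qed
      ultimately show ?thesis
        using cov by auto
    qed
    \<comment> \<open>\<open>C + x = (C + g) + (- g + x)\<close>, so the cosets of \<open>C\<close> are traded for translates by \<open>- g + x\<close>.\<close>
    let ?X = "X \<union> (\<lambda>(x, x'). x - g + x') ` (X \<times> X)"
    have "h \<in> (\<Union>D\<in>\<C>. D + ?X)" if "h \<in> H" for h
    proof (cases "h \<in> C + X")
      case True
      then obtain c x where h: "h = c + x" "c \<in> C" "x \<in> X"
        by (auto elim!: set_plus_elim)
      obtain D d x' where d: "c + g = d + x'" "d \<in> D" "D \<in> \<C>" "x' \<in> X"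
        using coset[OF h(2)] by (auto elim!: set_plus_elim)
      have "h = d + (x' - g + x)"
        using h(1) d(1) by (metis add.assoc add_diff_cancel add_diff_eq)
      moreover have "x' - g + x \<in> ?X"
        using d h by force
      ultimately have "h \<in> D + ?X"
        using d(2) by (metis set_plus_intro)
      then show ?thesis
        using d(3) by blast
    next
      case False
      then show ?thesis
        using cov that set_plus_mono2[OF subset_refl, of X ?X] by blast
    qed
    moreover have "finite ?X"
      using insert.prems(1) by auto
    ultimately show False
      using insert.IH[of ?X] insert.prems(2) by blast
  qed
qed

section \<open>Elements with few conjugates\<close>

definition centralizer :: "'a::group_add set \<Rightarrow> 'a \<Rightarrow> 'a set" where
  "centralizer H v = {h \<in> H. h + v = v + h}"

text \<open>
  The elements with finitely many conjugates under \<open>H\<close>, known as the FC-center.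
\<close>
definition fc_center :: "'a::group_add set \<Rightarrow> 'a set" where
  "fc_center H = {v \<in> H. finite_index H (centralizer H v)}"

lemma commute_minus:
  fixes x :: "'a::group_add"
  assumes "x + v = v + x"
  shows "- x + v = v + - x"
proof -
  have "- x + v + x = v"
    by (simp add: add.assoc flip: assms)
  then show ?thesis
    by (metis add_uminus_conv_diff eq_diff_eq)
qed

lemma commute_add:
  fixes x :: "'a::group_add"
  assumes "x + v = v + x" "y + v = v + y"
  shows "(x + y) + v = v + (x + y)"
  by (metis assms add.assoc)

lemma commute_diff:
  fixes x :: "'a::group_add"
  assumes "x + v = v + x" "y + v = v + y"
  shows "(x - y) + v = v + (x - y)"
  using commute_add[OF assms(1) commute_minus[OF assms(2)]] by simp

lemma is_subgroup_centralizer: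
  assumes "is_subgroup H"
  shows "is_subgroup (centralizer H v)"
  using assms by (auto simp: is_subgroup_def centralizer_def commute_diff)

lemma fc_center_diff:
  assumes H: "is_subgroup H" and "x \<in> fc_center H" "y \<in> fc_center H"
  shows "x - y \<in> fc_center H"
proof -
  have "finite_index H (centralizer H x \<inter> centralizer H y)"
    using assms by (intro finite_index_Int is_subgroup_centralizer) (auto simp: fc_center_def)
  moreover have "centralizer H x \<inter> centralizer H y \<subseteq> centralizer H (x - y)"
    by (auto simp: centralizer_def commute_diff)
  ultimately show ?thesis
    using assms by (auto simp: fc_center_def intro: finite_index_mono is_subgroup_diff)
qed

text \<open>
  The greedy construction of an infinite set whose elements are pairwise related. Both directions of \<open>R\<close>
  are required because a later element is compared with earlier ones in either order.
\<close>
lemma infinite_pairwise_set: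
  assumes "\<And>S. finite S \<Longrightarrow> S \<subseteq> X \<Longrightarrow> \<exists>x\<in>X - S. \<forall>s\<in>S. R s x \<and> R x s"
  obtains T where "T \<subseteq> X" "infinite T" "pairwise R T"
proof -
  define P where "P f n r \<longleftrightarrow> r \<in> X \<and> (\<forall>i<n. r \<noteq> f i \<and> R (f i) r \<and> R r (f i))" for f and n :: nat and r
  have "\<exists>f. \<forall>n. P f n (f n)"
  proof (rule dependent_wellorder_choice)
    show "\<exists>r. P f n r" if "\<And>m. m < n \<Longrightarrow> P f m (f m)" for n f
    proof -
      have "f ` {..<n} \<subseteq> X"
        using that by (auto simp: P_def)
      then obtain r where "r \<in> X - f ` {..<n}" "\<forall>s\<in>f ` {..<n}. R s r \<and> R r s"
        using assms[of "f ` {..<n}"] by auto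
      then show ?thesis
        unfolding P_def by blast
    qed
  qed (simp add: P_def)
  then obtain f where f: "\<And>n. P f n (f n)"
    by auto
  have lt: "f m \<noteq> f n \<and> R (f m) (f n) \<and> R (f n) (f m)" if "m < n" for m n
    using f[of n] that unfolding P_def by metis
  have "inj f"
  proof (rule linorder_injI)
    show "f m \<noteq> f n" if "m < n" for m n
      using lt[OF that] by blast
  qed
  moreover have "R (f m) (f n)" if "f m \<noteq> f n" for m n
    using that lt[of m n] lt[of n m] by (cases m n rule: linorder_cases) auto
  then have "pairwise R (range f)"
    by (auto simp: pairwise_def)
  moreover have "range f \<subseteq> X"
    using f by (auto simp: P_def)
  ultimately show thesis
    using that range_inj_infinite by blast
qed

text \<open>
  The common centralizer \<open>D\<close> of finitely many FC-elements has finite index, so infinitely many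
  FC-elements lie in one coset of \<open>D\<close>. Their differences are FC-elements in \<open>D\<close>, hence the greedy
  construction can go on.
\<close>
lemma infinite_commuting_set:
  assumes H: "is_subgroup H" and inf: "infinite (fc_center H)"
  obtains E where "E \<subseteq> H" "infinite E" "pairwise (\<lambda>x y. x + y = y + x) E"
proof -
  have "\<exists>x\<in>fc_center H - S. \<forall>s\<in>S. s + x = x + s \<and> x + s = s + x"
    if S: "finite S" "S \<subseteq> fc_center H" for S
  proof -
    define D where "D = {h\<in>H. \<forall>s\<in>S. h + s = s + h}"
    have "is_subgroup {h\<in>H. \<forall>s\<in>S. h + s = s + h} \<and> finite_index H {h\<in>H. \<forall>s\<in>S. h + s = s + h}"
      using S
    proof (induction S rule: finite_induct)
      case empty
      then show ?case
        using H by (simp add: finite_index_refl)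
    next
      case (insert v S)
      have "{h\<in>H. \<forall>s\<in>insert v S. h + s = s + h} = {h\<in>H. \<forall>s\<in>S. h + s = s + h} \<inter> centralizer H v"
        by (auto simp: centralizer_def)
      then show ?case
        using insert H
        by (auto simp: fc_center_def intro!: finite_index_Int is_subgroup_Int is_subgroup_centralizer)
    qed
    then have D: "is_subgroup D" and "finite_index H D"
      by (simp_all add: D_def)
    then obtain X where X: "finite X" "H \<subseteq> D + X"
      by (auto simp: finite_index_def)
    have "\<forall>z\<in>fc_center H. \<exists>x. x \<in> X \<and> z - x \<in> D"
    proof
      fix z assume "z \<in> fc_center H"
      then have "z \<in> D + X"
        using X by (auto simp: fc_center_def)
      then show "\<exists>x. x \<in> X \<and> z - x \<in> D"
        by (auto elim!: set_plus_elim)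
    qed
    then obtain f where f: "\<forall>z\<in>fc_center H. f z \<in> X \<and> z - f z \<in> D"
      by (rule bchoice[THEN exE])
    then have "finite (f ` fc_center H)"
      using X(1) by (meson finite_subset image_subsetI)
    then obtain z0 where z0: "z0 \<in> fc_center H" "infinite {z \<in> fc_center H. f z = f z0}"
      using pigeonhole_infinite[OF inf] by blast
    let ?Z = "(\<lambda>z. z - z0) ` {z \<in> fc_center H. f z = f z0}"
    have "infinite ?Z"
      using z0(2) by (subst finite_image_iff) (auto simp: inj_on_def)
    then obtain x where x: "x \<in> ?Z" "x \<notin> S"
      using S(1) by (meson finite_subset subsetI)
    then obtain z where z: "x = z - z0" "z \<in> fc_center H" "f z = f z0"
      by blast
    have "(z - f z) - (z0 - f z0) \<in> D"
      using D f z z0 by (blast intro: is_subgroup_diff)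
    then have "x \<in> D"
      using z by (simp add: diff_diff_eq2)
    moreover have "x \<in> fc_center H"
      using fc_center_diff[OF H] z z0 by blast
    ultimately show ?thesis
      using x by (intro bexI[of _ x]) (auto simp: D_def)
  qed
  then obtain E where "E \<subseteq> fc_center H" "infinite E" "pairwise (\<lambda>x y. x + y = y + x) E"
    by (rule infinite_pairwise_set)
  moreover have "fc_center H \<subseteq> H"
    by (auto simp: fc_center_def)
  ultimately show thesis
    using that[of E] by blast
qed

section \<open>Escaping the equation \<open>y + u + y = a\<close>\<close>

text \<open>
  The parameters \<open>a\<close> range over \<open>Y\<close> alone, so that they commute with the unknown \<open>y\<close> when \<open>Y\<close> is a
  commuting set, while the \<open>u\<close> are arbitrary in \<open>H\<close>. The restriction \<open>a + u \<noteq> 0\<close> is essential: in a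
  group of exponent two, every \<open>y\<close> solves \<open>y + u + y = u\<close>.
\<close>
definition evasive :: "'a::group_add set \<Rightarrow> 'a set \<Rightarrow> bool" where
  "evasive H Y \<longleftrightarrow>
     (\<forall>F U A. finite F \<longrightarrow> finite U \<longrightarrow> finite A \<longrightarrow> U \<subseteq> H \<longrightarrow> A \<subseteq> Y \<longrightarrow>
       (\<forall>a\<in>A. \<forall>u\<in>U. a + u \<noteq> 0) \<longrightarrow>
       (\<exists>y\<in>Y - F. \<forall>u\<in>U. \<forall>a\<in>A. y + u + y \<noteq> a))"

lemma evasiveD:
  assumes "evasive H Y" "finite F" "finite U" "finite A" "U \<subseteq> H" "A \<subseteq> Y"
    and "\<And>a u. a \<in> A \<Longrightarrow> u \<in> U \<Longrightarrow> a + u \<noteq> 0"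
  obtains y where "y \<in> Y" "y \<notin> F" "\<And>u a. u \<in> U \<Longrightarrow> a \<in> A \<Longrightarrow> y + u + y \<noteq> a"
proof -
  have "\<exists>y\<in>Y - F. \<forall>u\<in>U. \<forall>a\<in>A. y + u + y \<noteq> a"
    using assms(1)[unfolded evasive_def, THEN spec[of _ F], THEN spec[of _ U], THEN spec[of _ A]]
      assms(2-) by simp
  then show thesis
    using that by blast
qed

lemma double_of_solution:
  fixes y :: "'a::group_add"
  assumes "y + u + y = a" "a + y = y + a"
  shows "y + y = - u + a"
proof -
  have "u + y = - y + a"
    using assms(1) by (metis add.assoc minus_add_cancel)
  also have "\<dots> = a + - y"
    using commute_minus[of y a] assms(2) by simp
  finally have "u + (y + y) = a"
    by (simp flip: add.assoc)
  then show ?thesis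
    by (metis minus_add_cancel)
qed

text \<open>
  A solution satisfies \<open>y + y = - u + a\<close>. If doubling is injective on \<open>Y\<close>, this excludes one \<open>y\<close> per
  equation. If all doubles vanish, a solution would give \<open>u = a\<close> and hence \<open>a + u = 0\<close>.
\<close>
lemma evasive_commuting:
  fixes Y :: "'a::group_add set"
  assumes "infinite Y" and comm: "pairwise (\<lambda>x y. x + y = y + x) Y"
    and dbl: "inj_on (\<lambda>y. y + y) Y \<or> (\<forall>y\<in>Y. y + y = 0)"
  shows "evasive H Y"
  unfolding evasive_def
proof (intro allI impI)
  fix F U A :: "'a set"
  assume fin: "finite F" "finite U" "finite A" and A: "A \<subseteq> Y"
    and ne: "\<forall>a\<in>A. \<forall>u\<in>U. a + u \<noteq> 0"
  let ?bad = "{y\<in>Y. \<exists>u\<in>U. \<exists>a\<in>A. y + u + y = a}"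
  have sol: "y + y = - u + a" if "y \<in> Y" "a \<in> A" "y + u + y = a" for y u a
  proof (rule double_of_solution[OF that(3)])
    have "a \<in> Y"
      using A that by blast
    then show "a + y = y + a"
      using pairwiseD[OF comm, of a y] that by (cases "a = y") auto
  qed
  have "finite ?bad"
    using dbl
  proof
    assume inj: "inj_on (\<lambda>y. y + y) Y"
    let ?Q = "(\<lambda>(u, a). - u + a) ` (U \<times> A)"
    have "?bad \<subseteq> (\<lambda>y. y + y) -` ?Q \<inter> Y"
      using sol by fastforce
    moreover have "finite ((\<lambda>y. y + y) -` ?Q \<inter> Y)"
      using fin inj by (intro finite_vimage_IntI) auto
    ultimately show ?thesis
      by (rule finite_subset)
  next
    assume zero: "\<forall>y\<in>Y. y + y = 0"
    have "?bad = {}"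
    proof (rule ccontr)
      assume "?bad \<noteq> {}"
      then obtain y u a where y: "y \<in> Y" "u \<in> U" "a \<in> A" "y + u + y = a"
        by blast
      then have "u = a"
        using sol[OF y(1,3,4)] zero y(1) by (metis minus_minus minus_unique)
      then have "a + u = 0"
        using zero A y by blast
      then show False
        using ne y by blast
    qed
    then show ?thesis
      by (metis finite.emptyI)
  qed
  then have "infinite (Y - (F \<union> ?bad))"
    using assms(1) fin by (intro Diff_infinite_finite) auto
  then obtain y where "y \<in> Y - (F \<union> ?bad)"
    using infinite_imp_nonempty by blast
  then show "\<exists>y\<in>Y - F. \<forall>u\<in>U. \<forall>a\<in>A. y + u + y \<noteq> a"
    by blast
qed

text \<open>
  Doubling is injective on an infinite subset unless it has finite range on \<open>E\<close>. In the latter case it is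
  constant on an infinite subset, and subtracting one element \<open>e\<close> of that subset makes
  all doubles zero.
\<close>
lemma ex_evasive_of_commuting:
  fixes E :: "'a::group_add set"
  assumes H: "is_subgroup H" and E: "E \<subseteq> H" "infinite E"
    and comm: "pairwise (\<lambda>x y. x + y = y + x) E"
  shows "\<exists>Y\<subseteq>H. evasive H Y"
proof (cases "finite ((\<lambda>y. y + y) ` E)")
  case False
  obtain Y where Y: "Y \<subseteq> E" "inj_on (\<lambda>y. y + y) Y" "(\<lambda>y. y + y) ` E = (\<lambda>y. y + y) ` Y"
    using subset_image_inj[of "(\<lambda>y. y + y) ` E" "\<lambda>y. y + y" E] by auto
  then have "infinite Y"
    using False by auto
  then show ?thesis
    using evasive_commuting[of Y H] Y E comm by (meson order_trans pairwise_subset)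
next
  case True
  then obtain e where e: "e \<in> E" "infinite {y \<in> E. y + y = e + e}"
    using pigeonhole_infinite[OF E(2)] by blast
  let ?Y = "(\<lambda>y. y - e) ` {y \<in> E. y + y = e + e}"
  have c: "x + y = y + x" if "x \<in> E" "y \<in> E" for x y
    using that pairwiseD[OF comm, of x y] by (cases "x = y") auto
  have "infinite ?Y"
    using e(2) by (subst finite_image_iff) (auto simp: inj_on_def)
  moreover have "(x - e) + (y - e) = (y - e) + (x - e)" if "x \<in> E" "y \<in> E" for x y
  proof (rule commute_diff)
    show "x + (y - e) = y - e + x" "e + (y - e) = y - e + e"
      using commute_diff[of y x e] commute_diff[of y e e] c that e(1) by simp_all
  qed
  then have "pairwise (\<lambda>x y. x + y = y + x) ?Y"
    by (auto simp: pairwise_def)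
  moreover have "(y - e) + (y - e) = 0" if "y \<in> E" "y + y = e + e" for y
  proof -
    have "(y - e) + (y - e) = y + (y - e) - e"
      using commute_diff[of y y e] c[OF e(1) that(1)]
      by (simp add: add_diff_eq)
    also have "\<dots> = (y + y) - (e + e)"
      by (simp only: add_diff_eq diff_add_eq_diff_diff_swap)
    finally show ?thesis
      using that by simp
  qed
  ultimately have "evasive H ?Y"
    by (intro evasive_commuting) auto
  moreover have "?Y \<subseteq> H"
    using E e H by (auto intro: is_subgroup_diff)
  ultimately show ?thesis
    by blast
qed

text \<open>
  The equation \<open>v + s + v = s\<close> says that conjugation by \<open>s\<close> inverts \<open>v\<close>; two such
  conjugations cancel.
\<close>
lemma coset_of_inverting_elements:
  fixes s :: "'a::group_add"
  assumes "v + s + v = s" "v + r + v = r"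
  shows "(s - r) + v = v + (s - r)"
proof -
  have s: "v + s = s - v"
    using assms(1) by (simp add: eq_diff_eq)
  have "- r = - v - r - v"
    using arg_cong[OF assms(2), of uminus] by (simp only: group_normalize)
  then have "- r + v = - v - r"
    by (metis diff_add_cancel)
  then have "s - r + v = s - v - r"
    by (metis add.assoc add_uminus_conv_diff)
  also have "\<dots> = v + (s - r)"
    by (metis s add_diff_eq)
  finally show ?thesis .
qed

text \<open>
  Suppose finitely many equations, indexed by \<open>U \<times> A\<close>, cover \<open>H - F\<close>. Take a set \<open>T\<close> with
  more elements than there are equations. For given \<open>y\<close>, two of the elements \<open>y + t\<close>, \<open>t \<in> T\<close>, solve the
  same equation (unless some \<open>y + t\<close> lies in \<open>F\<close>). With \<open>s = y + t + u\<close> and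
  \<open>v = - u - t + t' + u\<close> this means \<open>s + s = a + u = (s + v) + (s + v)\<close>, so \<open>s\<close> inverts \<open>v\<close>, which places
  \<open>y\<close> in one of finitely many right cosets of the centralizer of \<open>v\<close>. If the FC-center were finite, \<open>T\<close> could be
  chosen such that none of these \<open>v\<close> is an FC-element, contradicting Neumann's lemma.
\<close>
lemma infinite_fc_center_if_not_evasive:
  fixes H :: "'a::group_add set"
  assumes H: "is_subgroup H" "infinite H" and ne: "\<not> evasive H H"
  shows "infinite (fc_center H)"
proof
  assume fc: "finite (fc_center H)"
  obtain F U A where fin: "finite F" "finite U" "finite A" and sub: "U \<subseteq> H" "A \<subseteq> H"
    and cov: "\<And>y. y \<in> H - F \<Longrightarrow> \<exists>u\<in>U. \<exists>a\<in>A. y + u + y = a"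
  proof -
    have "\<exists>F U A. finite F \<and> finite U \<and> finite A \<and> U \<subseteq> H \<and> A \<subseteq> H \<and>
        \<not> (\<exists>y\<in>H - F. \<forall>u\<in>U. \<forall>a\<in>A. y + u + y \<noteq> a)"
      using ne unfolding evasive_def by meson
    then show thesis
      using that by (elim exE conjE) simp
  qed
  have "\<exists>x\<in>H - S. \<forall>s\<in>S. (\<forall>u\<in>U. - u - s + x + u \<notin> fc_center H) \<and> (\<forall>u\<in>U. - u - x + s + u \<notin> fc_center H)"
    if S: "finite S" "S \<subseteq> H" for S
  proof -
    \<comment> \<open>The conditions \<open>- u - s + x + u = f\<close> and \<open>- u - x + s + u = f\<close> solved for \<open>x\<close>.\<close>
    define G where "G = (\<Union>s\<in>S. \<Union>u\<in>U. (\<lambda>f. s + u + f - u) ` fc_center H \<union> (\<lambda>f. s + u - f - u) ` fc_center H)"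
    have "finite (S \<union> G)"
      unfolding G_def using S fin fc by simp
    then have "infinite (H - (S \<union> G))"
      using H(2) by (rule Diff_infinite_finite)
    then obtain x where x: "x \<in> H" "x \<notin> S" "x \<notin> G"
      using infinite_imp_nonempty by blast
    have eq1: "x = s + u + (- u - s + x + u) - u" for s u
      by (simp only: group_normalize)
    have eq2: "x = s + u - (- u - x + s + u) - u" for s u
      by (simp only: group_normalize)
    have notin: "- u - s + x + u \<notin> fc_center H \<and> - u - x + s + u \<notin> fc_center H" if "s \<in> S" "u \<in> U" for s u
    proof (intro conjI notI)
      assume "- u - s + x + u \<in> fc_center H"
      with eq1 have "x \<in> (\<lambda>f. s + u + f - u) ` fc_center H"
        by (rule image_eqI)
      then show False
        using x(3) that unfolding G_def by blast
    next
      assume "- u - x + s + u \<in> fc_center H"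
      with eq2 have "x \<in> (\<lambda>f. s + u - f - u) ` fc_center H"
        by (rule image_eqI)
      then show False
        using x(3) that unfolding G_def by blast
    qed
    show ?thesis
      by (rule bexI[of _ x]) (use x notin in blast)+
  qed
  then obtain T0 where T0: "T0 \<subseteq> H" "infinite T0"
      "pairwise (\<lambda>t t'. \<forall>u\<in>U. - u - t + t' + u \<notin> fc_center H) T0"
    using infinite_pairwise_set[of H "\<lambda>t t'. \<forall>u\<in>U. - u - t + t' + u \<notin> fc_center H"] by blast
  obtain T where T: "T \<subseteq> T0" "finite T" "card T = Suc (card (U \<times> A))"
    using infinite_arbitrarily_large[OF T0(2)] by blast
  define V where "V = (\<Union>u\<in>U. \<Union>t\<in>T. (\<lambda>t'. - u - t + t' + u) ` (T - {t}))"
  have TH: "T \<subseteq> H"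
    using T T0 by auto
  have V: "v \<in> H \<and> v \<notin> fc_center H" if vV: "v \<in> V" for v
  proof -
    obtain u t t' where v: "v = - u - t + t' + u" and u: "u \<in> U" and t: "t \<in> T" "t' \<in> T" "t \<noteq> t'"
      using vV unfolding V_def by blast
    have "v \<in> H"
      unfolding v using u t TH sub H(1) by (blast intro: is_subgroup_closed)
    moreover have "v \<notin> fc_center H"
      unfolding v using pairwiseD[OF T0(3), of t t'] u t T(1) by blast
    ultimately show ?thesis
      by blast
  qed
  have "finite V"
    unfolding V_def using fin T by simp
  \<comment> \<open>One element inverting \<open>v\<close>, if there is any; it represents the coset of all of them.\<close>
  define r where "r v = (SOME s. s \<in> H \<and> v + s + v = s)" for v
  have r: "s - r v \<in> centralizer H v" if "v + s + v = s" "s \<in> H" for s v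
  proof -
    have "r v \<in> H \<and> v + r v + v = r v"
      unfolding r_def using that by (intro someI[of "\<lambda>s. s \<in> H \<and> v + s + v = s" s]) simp
    then show ?thesis
      using that H(1) by (simp add: centralizer_def is_subgroup_diff coset_of_inverting_elements)
  qed
  define X where "X = (\<lambda>(f, t). f - t) ` (F \<times> T) \<union> (\<lambda>(v, u, t). r v - u - t) ` (V \<times> U \<times> T)"
  \<comment> \<open>The finite exceptional set enters as a set of cosets of the trivial subgroup.\<close>
  let ?\<C> = "insert {0} (centralizer H ` V)"
  have "\<exists>C\<in>?\<C>. y \<in> C + X" if y: "y \<in> H" for y
  proof (cases "\<exists>t\<in>T. y + t \<in> F")
    case True
    then obtain t where "t \<in> T" "y + t \<in> F"
      by blast
    then have "(y + t) - t \<in> X"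
      unfolding X_def by blast
    then have "y \<in> {0} + X"
      using set_plus_intro[of 0 "{0}" y X] by simp
    then show ?thesis
      by blast
  next
    case False
    have "\<forall>t\<in>T. \<exists>p. p \<in> U \<times> A \<and> y + t + fst p + (y + t) = snd p"
    proof
      fix t assume "t \<in> T"
      then have "y + t \<in> H - F"
        using False TH y H(1) by (auto intro: is_subgroup_add)
      then show "\<exists>p. p \<in> U \<times> A \<and> y + t + fst p + (y + t) = snd p"
        using cov by fastforce
    qed
    then obtain p where p: "\<forall>t\<in>T. p t \<in> U \<times> A \<and> y + t + fst (p t) + (y + t) = snd (p t)"
      by (rule bchoice[THEN exE])
    have "\<not> inj_on p T"
    proof
      assume "inj_on p T"
      moreover have "p ` T \<subseteq> U \<times> A" "finite (U \<times> A)"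
        using p fin by auto
      ultimately have "card T \<le> card (U \<times> A)"
        by (rule card_inj_on_le)
      then show False
        using T by simp
    qed
    then obtain t t' where t: "t \<in> T" "t' \<in> T" "t \<noteq> t'" "p t = p t'"
      by (auto simp: inj_on_def)
    define u where "u = fst (p t)"
    define v where "v = - u - t + t' + u"
    define s where "s = y + t + u"
    have u: "u \<in> U"
      using p t unfolding u_def by (metis mem_Times_iff)
    then have v: "v \<in> V"
      unfolding V_def v_def using t by blast
    have s': "s + v = y + t' + u"
      by (simp only: s_def v_def group_normalize)
    have "y + t + u + (y + t) = y + t' + u + (y + t')"
      using p t unfolding u_def by metis
    then have "s + s = (s + v) + (s + v)"
      unfolding s' unfolding s_def by (metis add.assoc)
    then have "v + s + v = s"
      by (simp add: add.assoc)
    moreover have "s \<in> H"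
      unfolding s_def using y t TH u sub H(1) by (auto intro: is_subgroup_add)
    ultimately have "s - r v \<in> centralizer H v"
      by (rule r)
    moreover have "r v - u - t \<in> X"
      unfolding X_def using v u t by force
    moreover have "y = (s - r v) + (r v - u - t)"
      by (simp only: s_def group_normalize)
    ultimately have "y \<in> centralizer H v + X"
      by (metis set_plus_intro)
    then show ?thesis
      using v by blast
  qed
  moreover have "\<not> H \<subseteq> (\<Union>C\<in>?\<C>. C + X)"
  proof (rule not_covered_by_cosets_of_infinite_index)
    show "finite ?\<C>" "finite X"
      unfolding X_def using \<open>finite V\<close> fin T by auto
    have "\<not> finite_index H {0}"
      using H(2) unfolding finite_index_def by (metis add_0 finite_subset set_zero)
    then show "is_subgroup C \<and> C \<subseteq> H \<and> \<not> finite_index H C" if "C \<in> ?\<C>" for C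
      using that H(1) V is_subgroup_centralizer[OF H(1)]
      by (auto simp: fc_center_def is_subgroup_zero) (auto simp: is_subgroup_def centralizer_def)
  qed (rule H)
  ultimately show False
    by blast
qed

lemma ex_evasive:
  assumes "is_subgroup H" "infinite H"
  shows "\<exists>Y\<subseteq>H. evasive H Y"
proof (cases "evasive H H")
  case False
  with assms have "infinite (fc_center H)"
    by (rule infinite_fc_center_if_not_evasive)
  with assms(1) obtain E where "E \<subseteq> H" "infinite E" "pairwise (\<lambda>x y. x + y = y + x) E"
    by (rule infinite_commuting_set)
  with assms(1) show ?thesis
    by (rule ex_evasive_of_commuting)
qed blast

section \<open>Factorizations by finite approximation\<close>

text \<open>
  Uniqueness of \<open>a\<close> implies uniqueness of \<open>b\<close> by cancellation.
\<close>
definition direct :: "'a::group_add set \<Rightarrow> 'a set \<Rightarrow> bool" where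
  "direct A B \<longleftrightarrow> (\<forall>a\<in>A. \<forall>b\<in>B. \<forall>a'\<in>A. \<forall>b'\<in>B. a + b = a' + b' \<longrightarrow> a = a')"

lemma directD:
  "direct A B \<Longrightarrow> a + b = a' + b' \<Longrightarrow> a \<in> A \<Longrightarrow> b \<in> B \<Longrightarrow> a' \<in> A \<Longrightarrow> b' \<in> B \<Longrightarrow> a = a'"
  unfolding direct_def by blast

lemma direct_insert_left:
  assumes "direct A B" and y: "\<And>b. b \<in> B \<Longrightarrow> y + b \<notin> A + B"
  shows "direct (insert y A) B"
  unfolding direct_def
proof (intro ballI impI)
  fix a b a' b'
  assume eq: "a + b = a' + b'" and b: "b \<in> B" "b' \<in> B" and a: "a \<in> insert y A" "a' \<in> insert y A"
  have "y + b \<noteq> a' + b'" if "a' \<in> A"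
    using y[OF b(1)] set_plus_intro[OF that b(2)] by auto
  moreover have "y + b' \<noteq> a + b" if "a \<in> A"
    using y[OF b(2)] set_plus_intro[OF that b(1)] by auto
  ultimately show "a = a'"
    using a b eq directD[OF assms(1) eq] by auto
qed

lemma direct_insert_right:
  assumes "direct A B" and c: "\<And>a. a \<in> A \<Longrightarrow> a + c \<notin> A + B"
  shows "direct A (insert c B)"
  unfolding direct_def
proof (intro ballI impI)
  fix a b a' b'
  assume eq: "a + b = a' + b'" and b: "b \<in> insert c B" "b' \<in> insert c B" and a: "a \<in> A" "a' \<in> A"
  have "a + c \<noteq> a' + b'" if "b' \<in> B"
    using c[OF a(1)] set_plus_intro[OF a(2) that] by auto
  moreover have "a' + c \<noteq> a + b" if "b \<in> B"
    using c[OF a(2)] set_plus_intro[OF a(1) that] by auto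
  ultimately show "a = a'"
    using a b eq directD[OF assms(1) eq] by auto
qed

definition partial_factorization :: "'a::group_add set \<Rightarrow> 'a set \<Rightarrow> 'a set \<Rightarrow> 'a set \<Rightarrow> bool" where
  "partial_factorization H Y A B \<longleftrightarrow>
     finite A \<and> finite B \<and> A \<subseteq> Y \<and> B \<subseteq> H \<and> direct A B"

text \<open>
  The new elements are \<open>y\<close> in \<open>A\<close> and \<open>- y + g\<close> in \<open>B\<close>. All coincidences of sums that involve \<open>y\<close>
  once determine \<open>y\<close>, so they are avoided by a finite set \<open>F\<close>. The remaining coincidence
  \<open>y + b = a + (- y + g)\<close> is the equation that an evasive set escapes.
\<close>
lemma extend_by_product:
  assumes H: "is_subgroup H" and Y: "Y \<subseteq> H" "evasive H Y"
    and AB: "partial_factorization H Y A B" and g: "g \<in> H"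
  shows "\<exists>A' B'. partial_factorization H Y A' B' \<and> A \<subseteq> A' \<and> B \<subseteq> B' \<and> g \<in> A' + B'"
proof (cases "g \<in> A + B")
  case True
  then show ?thesis
    using AB by blast
next
  case False
  have fin: "finite A" "finite B" and sub: "A \<subseteq> Y" "B \<subseteq> H" and dir: "direct A B"
    using AB by (simp_all add: partial_factorization_def)
  define F where "F = (\<Union>a\<in>A. \<Union>b\<in>B. (\<lambda>b'. a + b - b') ` B \<union> (\<lambda>a'. g - b - a + a') ` A)
    \<union> (\<lambda>b. g - b) ` B"
  define U where "U = (\<lambda>b. b - g) ` B"
  have "finite F" "finite U"
    using fin by (simp_all add: F_def U_def)
  moreover have "U \<subseteq> H"
    using sub H g by (auto simp: U_def intro: is_subgroup_diff)
  moreover have "a + u \<noteq> 0" if a: "a \<in> A" and u: "u \<in> U" for a u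
  proof
    assume "a + u = 0"
    moreover obtain b where b: "b \<in> B" "u = b - g"
      using u unfolding U_def by blast
    ultimately have "g = a + b"
      by (simp add: add_diff_eq)
    then show False
      using False a b by (metis set_plus_intro)
  qed
  ultimately obtain y where y: "y \<in> Y" "y \<notin> F" "\<And>u a. u \<in> U \<Longrightarrow> a \<in> A \<Longrightarrow> y + u + y \<noteq> a"
    using evasiveD[OF Y(2) _ _ fin(1) _ sub(1)] by metis
  have yB: "y + b \<notin> A + B" if "b \<in> B" for b
  proof
    assume "y + b \<in> A + B"
    then obtain a b' where a: "y + b = a + b'" "a \<in> A" "b' \<in> B"
      by (rule set_plus_elim)
    then have "y = a + b' - b"
      by (simp add: eq_diff_eq)
    then have "y \<in> F"
      unfolding F_def using that a(2,3) by blast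
    then show False
      using y by simp
  qed
  have "a + (- y + g) \<notin> insert y A + B" if a: "a \<in> insert y A" for a
  proof
    assume "a + (- y + g) \<in> insert y A + B"
    then obtain a' b where a': "a + (- y + g) = a' + b" "a' \<in> insert y A" and b: "b \<in> B"
      by (rule set_plus_elim)
    consider "a = y" "a' = y" | "a = y" "a' \<in> A" | "a \<in> A" "a' = y" | "a \<in> A" "a' \<in> A"
      using a a' by blast
    then show False
    proof cases
      case 1
      then have "y = g - b"
        using a' by (simp add: eq_diff_eq flip: add.assoc)
      then show False
        using y(2) b unfolding F_def by blast
    next
      case 2
      then show False
        using a' b \<open>g \<notin> A + B\<close> by (simp add: set_plus_intro flip: add.assoc)
    next
      case 3
      have "a = y + b - (- y + g)"
        using a'(1) 3 by (metis add_diff_cancel)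
      also have "\<dots> = y + (b - g) + y"
        by (simp only: group_normalize)
      finally show False
        using y(3)[of "b - g" a] b 3 unfolding U_def by blast
    next
      case 4
      have "- y = - a + a' + b - g"
        using a'(1) by (metis add.assoc add_diff_cancel minus_add_cancel)
      then have "y = - (- a + a' + b - g)"
        by (metis minus_minus)
      also have "\<dots> = g - b - a' + a"
        by (simp only: group_normalize)
      finally show False
        using y(2) b 4 unfolding F_def by blast
    qed
  qed
  then have "direct (insert y A) (insert (- y + g) B)"
    using dir yB by (intro direct_insert_right direct_insert_left)
  moreover have "- y + g \<in> H"
    using H Y(1) y(1) g by (blast intro: is_subgroup_closed)
  ultimately have "partial_factorization H Y (insert y A) (insert (- y + g) B)"
    using fin sub y(1) by (simp add: partial_factorization_def)
  moreover have "y + (- y + g) \<in> insert y A + insert (- y + g) B"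
    by (rule set_plus_intro) simp_all
  ultimately show ?thesis
    by (metis add_minus_cancel subset_insertI)
qed

lemma extend_left:
  assumes "evasive H Y" and AB: "partial_factorization H Y A B"
  shows "\<exists>y. y \<notin> A \<and> partial_factorization H Y (insert y A) B"
proof -
  have fin: "finite A" "finite B" and dir: "direct A B"
    using AB by (simp_all add: partial_factorization_def)
  define F where "F = A \<union> (\<Union>a\<in>A. \<Union>b\<in>B. (\<lambda>b'. a + b - b') ` B)"
  have "finite F"
    using fin by (simp add: F_def)
  then obtain y where y: "y \<in> Y" "y \<notin> F"
    using evasiveD[OF assms(1), of F "{}" "{}"] by auto
  have "y + b \<notin> A + B" if "b \<in> B" for b
  proof
    assume "y + b \<in> A + B"
    then obtain a b' where a: "y + b = a + b'" "a \<in> A" "b' \<in> B"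
      by (rule set_plus_elim)
    then have "y = a + b' - b"
      by (simp add: eq_diff_eq)
    then have "y \<in> F"
      unfolding F_def using that a(2,3) by blast
    then show False
      using y by simp
  qed
  then have "direct (insert y A) B"
    by (rule direct_insert_left[OF dir])
  moreover have "y \<notin> A"
    using y by (simp add: F_def)
  ultimately show ?thesis
    using AB y(1) by (auto simp: partial_factorization_def)
qed

lemma extend_right:
  fixes c :: "nat \<Rightarrow> 'a::group_add"
  assumes H: "is_subgroup H" and c: "inj c" "range c \<subseteq> H"
    and AB: "partial_factorization H Y A B" and h: "h \<in> H"
  shows "\<exists>n\<ge>m. partial_factorization H Y A (insert (h + c n) B)"
proof -
  have fin: "finite A" "finite B" and dir: "direct A B"
    using AB by (simp_all add: partial_factorization_def)
  define F where "F = (\<Union>a\<in>A. \<Union>a'\<in>A. (\<lambda>b. - a + (a' + b)) ` B)"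
  have "inj (\<lambda>n. h + c n)"
    using c(1) by (simp add: inj_def)
  moreover have "finite F"
    using fin by (simp add: F_def)
  ultimately have "finite ((\<lambda>n. h + c n) -` F)"
    by (intro finite_vimageI)
  then have "infinite ({m..} - (\<lambda>n. h + c n) -` F)"
    using infinite_Ici by (rule Diff_infinite_finite)
  then obtain n where n: "n \<ge> m" "h + c n \<notin> F"
    using infinite_imp_nonempty by blast
  have "a + (h + c n) \<notin> A + B" if "a \<in> A" for a
  proof
    assume "a + (h + c n) \<in> A + B"
    then obtain a' b where a': "a + (h + c n) = a' + b" "a' \<in> A" "b \<in> B"
      by (rule set_plus_elim)
    then have "h + c n = - a + (a' + b)"
      by (metis minus_add_cancel)
    then have "h + c n \<in> F"
      unfolding F_def using that a'(2,3) by blast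
    then show False
      using n by simp
  qed
  then have "direct A (insert (h + c n) B)"
    by (rule direct_insert_right[OF dir])
  moreover have "h + c n \<in> H"
    using H h c(2) by (auto intro: is_subgroup_add)
  ultimately have "partial_factorization H Y A (insert (h + c n) B)"
    using AB by (simp add: partial_factorization_def)
  then show ?thesis
    using n by blast
qed

lemma extend_step:
  fixes c :: "nat \<Rightarrow> 'a::group_add"
  assumes "is_subgroup H" "Y \<subseteq> H" "evasive H Y" "inj c" "range c \<subseteq> H"
    and "partial_factorization H Y A B" "g \<in> H"
  shows "\<exists>A' B'. partial_factorization H Y A' B' \<and> A \<subset> A' \<and> B \<subseteq> B' \<and>
    g \<in> A' + B' \<and> (\<exists>n\<ge>m. g + c n \<in> B')"
proof -
  obtain A1 B1 where 1: "partial_factorization H Y A1 B1" "A \<subseteq> A1" "B \<subseteq> B1" "g \<in> A1 + B1"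
    using extend_by_product assms by metis
  obtain y where 2: "y \<notin> A1" "partial_factorization H Y (insert y A1) B1"
    using extend_left assms(3) 1(1) by metis
  obtain n where 3: "n \<ge> m" "partial_factorization H Y (insert y A1) (insert (g + c n) B1)"
    using extend_right[OF assms(1,4,5) 2(2) assms(7)] by metis
  have "g \<in> insert y A1 + insert (g + c n) B1"
    using 1(4) set_plus_mono2[of A1 "insert y A1" B1 "insert (g + c n) B1"] by blast
  then show ?thesis
    using 1 2 3 by (intro exI[of _ "insert y A1"] exI[of _ "insert (g + c n) B1"]) blast
qed

text \<open>
  Every pair \<open>(h, m)\<close> is treated at some stage, where \<open>h\<close> becomes a product and some \<open>h + c n\<close> with
  \<open>n \<ge> m\<close> enters \<open>B\<close>. As \<open>A\<close> grows strictly at each stage, its union is infinite.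
\<close>
lemma ex_factorization:
  fixes c :: "nat \<Rightarrow> 'a::group_add"
  assumes H: "is_subgroup H" "countable H" and c: "inj c" "range c \<subseteq> H"
  obtains A B where "A \<subseteq> H" "infinite A" "direct A B" "A + B = H"
    "\<forall>h\<in>H. \<forall>m. \<exists>n\<ge>m. h + c n \<in> B"
proof -
  have "infinite H"
    using c finite_subset range_inj_infinite by blast
  then obtain Y where Y: "Y \<subseteq> H" "evasive H Y"
    using ex_evasive[OF H(1)] by blast
  define g where "g k = from_nat_into H (fst (prod_decode k))" for k
  have gH: "g k \<in> H" for k
    using is_subgroup_zero[OF H(1)] unfolding g_def by (intro from_nat_into) blast
  have ex_g: "\<exists>k. g k = h \<and> snd (prod_decode k) = m" if "h \<in> H" for h m
    unfolding g_def
    by (rule exI[of _ "prod_encode (to_nat_on H h, m)"]) (simp add: that H(2))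
  define Q where "Q k P P' \<longleftrightarrow> fst P \<subset> fst P' \<and> snd P \<subseteq> snd P' \<and> g k \<in> fst P' + snd P' \<and>
    (\<exists>n\<ge>snd (prod_decode k). g k + c n \<in> snd P')" for k and P P' :: "'a set \<times> 'a set"
  have "\<exists>f. \<forall>k. partial_factorization H Y (fst (f k)) (snd (f k)) \<and> Q k (f k) (f (Suc k))"
  proof (rule dependent_nat_choice)
    have "partial_factorization H Y {} {}"
      by (simp add: partial_factorization_def direct_def)
    then show "\<exists>P. partial_factorization H Y (fst P) (snd P)"
      by (metis fst_conv snd_conv)
    show "\<exists>P'. partial_factorization H Y (fst P') (snd P') \<and> Q k P P'"
      if P: "partial_factorization H Y (fst P) (snd P)" for P k
    proof -
      obtain A' B' where "partial_factorization H Y A' B' \<and> fst P \<subset> A' \<and> snd P \<subseteq> B' \<and>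
          g k \<in> A' + B' \<and> (\<exists>n\<ge>snd (prod_decode k). g k + c n \<in> B')"
        using extend_step[OF H(1) Y c P gH[of k], of "snd (prod_decode k)"] by (elim exE)
      then show ?thesis
        by (intro exI[of _ "(A', B')"]) (simp add: Q_def)
    qed
  qed
  then obtain f where f: "\<And>k. partial_factorization H Y (fst (f k)) (snd (f k))" "\<And>k. Q k (f k) (f (Suc k))"
    by blast
  define A B where "A = (\<Union>k. fst (f k))" and "B = (\<Union>k. snd (f k))"
  have less: "fst (f k) \<subset> fst (f l)" if "k < l" for k l
  proof (rule lift_Suc_mono_less[of "\<lambda>k. fst (f k)", OF _ that])
    show "fst (f n) \<subset> fst (f (Suc n))" for n
      using f(2)[of n] unfolding Q_def by blast
  qed
  have monoA: "fst (f k) \<subseteq> fst (f l)" if "k \<le> l" for k l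
    using less[of k l] that by (cases "k = l") auto
  have monoB: "snd (f k) \<subseteq> snd (f l)" if "k \<le> l" for k l
  proof (rule lift_Suc_mono_le[of "\<lambda>k. snd (f k)", OF _ that])
    show "snd (f n) \<subseteq> snd (f (Suc n))" for n
      using f(2)[of n] unfolding Q_def by blast
  qed
  have sub: "A \<subseteq> H" "B \<subseteq> H"
    using f(1) Y(1) unfolding A_def B_def partial_factorization_def by blast+
  have "infinite A"
  proof
    assume "finite A"
    moreover have "range (\<lambda>k. fst (f k)) \<subseteq> Pow A"
      by (auto simp: A_def)
    ultimately have "finite (range (\<lambda>k. fst (f k)))"
      by (meson finite_Pow_iff finite_subset)
    moreover have "inj (\<lambda>k. fst (f k))"
    proof (rule linorder_injI)
      show "fst (f k) \<noteq> fst (f l)" if "k < l" for k l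
        using less[OF that] by blast
    qed
    ultimately show False
      using range_inj_infinite by blast
  qed
  moreover have "direct A B"
    unfolding direct_def
  proof (intro ballI impI)
    fix a b a' b'
    assume "a \<in> A" "b \<in> B" "a' \<in> A" "b' \<in> B" and eq: "a + b = a' + b'"
    then obtain i j k l where "a \<in> fst (f i)" "b \<in> snd (f j)" "a' \<in> fst (f k)" "b' \<in> snd (f l)"
      by (auto simp: A_def B_def)
    then have "a \<in> fst (f (i + j + k + l))" "b \<in> snd (f (i + j + k + l))"
        "a' \<in> fst (f (i + j + k + l))" "b' \<in> snd (f (i + j + k + l))"
      using monoA[of i "i + j + k + l"] monoB[of j "i + j + k + l"]
        monoA[of k "i + j + k + l"] monoB[of l "i + j + k + l"] by auto
    then show "a = a'"
      using f(1)[of "i + j + k + l"] directD[OF _ eq] unfolding partial_factorization_def by blast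
  qed
  moreover have "A + B = H"
  proof
    show "A + B \<subseteq> H"
      using sub H(1) by (blast elim: set_plus_elim intro: is_subgroup_add)
    show "H \<subseteq> A + B"
    proof
      fix h assume "h \<in> H"
      then obtain k where "g k = h"
        using ex_g by blast
      then have "h \<in> fst (f (Suc k)) + snd (f (Suc k))"
        using f(2)[of k] by (simp add: Q_def)
      moreover have "fst (f (Suc k)) \<subseteq> A" "snd (f (Suc k)) \<subseteq> B"
        by (auto simp: A_def B_def)
      ultimately show "h \<in> A + B"
        using set_plus_mono2 by blast
    qed
  qed
  moreover have "\<exists>n\<ge>m. h + c n \<in> B" if h: "h \<in> H" for h m
  proof -
    obtain k where "g k = h" "snd (prod_decode k) = m"
      using ex_g[OF h] by blast
    then obtain n where "n \<ge> m" "h + c n \<in> snd (f (Suc k))"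
      using f(2)[of k] by (auto simp: Q_def)
    then show ?thesis
      unfolding B_def by blast
  qed
  ultimately show thesis
    using that[OF sub(1)] by simp
qed

section \<open>Box resolvability\<close>

theorem theorem1:
  fixes a :: "nat \<Rightarrow> 'a::topological_group_add"
  assumes "inj a" and "convergent a"
  shows "box_resolvable TYPE('a) natLeq"
proof -
  obtain l where l: "a \<longlonglongrightarrow> l"
    using assms(2) by (auto simp: convergent_def)
  define c where "c n = a n - l" for n
  have c0: "c \<longlonglongrightarrow> 0"
    unfolding c_def using tendsto_diff[OF l tendsto_const[of l]] by simp
  have "inj c"
    using assms(1) unfolding c_def by (intro injI) (metis diff_add_cancel injD)
  have "countable (range c)"
    by simp
  then obtain H where H: "is_subgroup H" "countable H" "range c \<subseteq> H"
    by (rule countable_subgroup_hull)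
  obtain A B where AH: "A \<subseteq> H" and "infinite A" and dir: "direct A B" and AB: "A + B = H"
    and dense: "\<forall>h\<in>H. \<forall>m. \<exists>n\<ge>m. h + c n \<in> B"
    by (rule ex_factorization[OF H(1,2) \<open>inj c\<close> H(3)])
  have BH: "B \<subseteq> H"
  proof
    fix b assume b: "b \<in> B"
    obtain x where x: "x \<in> A"
      using \<open>infinite A\<close> infinite_imp_nonempty by blast
    then have "x + b \<in> H"
      using set_plus_intro[OF x b] AB by simp
    then have "- x + (x + b) \<in> H"
      using H(1) AH x by (blast intro: is_subgroup_closed)
    then show "b \<in> H"
      by simp
  qed
  \<comment> \<open>The predicate depends on the coset \<open>H + x\<close> only, so \<open>r\<close> picks one point from each right coset.\<close>
  define r where "r x = (SOME t. x - t \<in> H)" for x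
  have r: "x - r x \<in> H" for x
    unfolding r_def using is_subgroup_zero[OF H(1)] by (intro someI[of "\<lambda>t. x - t \<in> H" x]) simp
  have r_eq: "r (h + x) = r x" if "h \<in> H" for h x
  proof -
    have "h + x - t \<in> H \<longleftrightarrow> x - t \<in> H" for t
    proof
      assume "h + x - t \<in> H"
      then have "- h + (h + x - t) \<in> H"
        using H(1) that by (blast intro: is_subgroup_closed)
      then show "x - t \<in> H"
        by (simp add: add_diff_eq flip: add.assoc)
    next
      assume "x - t \<in> H"
      then have "h + (x - t) \<in> H"
        using H(1) that by (blast intro: is_subgroup_closed)
      then show "h + x - t \<in> H"
        by (simp add: add_diff_eq)
    qed
    then show ?thesis
      by (simp add: r_def)
  qed
  define T where "T = range r"
  have rT: "r t = t" if "t \<in> T" for t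
  proof -
    obtain x where "t = r x"
      using \<open>t \<in> T\<close> by (auto simp: T_def)
    then show ?thesis
      using r_eq[OF r[of x], of "r x"] by simp
  qed
  have "closure (B + T) = UNIV"
  proof -
    \<comment> \<open>\<open>h + c n + t\<close> tends to \<open>x = h + t\<close> and lies in \<open>B + T\<close> for infinitely many \<open>n\<close>.\<close>
    have "x \<in> closure (B + T)" for x
      unfolding closure_iff_nhds_not_empty
    proof (intro allI impI)
      fix V S assume S: "S \<subseteq> V" "open S" "x \<in> S"
      have "(\<lambda>n. (x - r x) + c n + r x) \<longlonglongrightarrow> (x - r x) + 0 + r x"
        by (intro tendsto_add tendsto_const c0)
      then have "eventually (\<lambda>n. (x - r x) + c n + r x \<in> S) sequentially"
        using S by (intro topological_tendstoD) simp_all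
      then obtain m where m: "\<And>n. n \<ge> m \<Longrightarrow> (x - r x) + c n + r x \<in> S"
        by (auto simp: eventually_sequentially)
      obtain n where n: "n \<ge> m" "(x - r x) + c n \<in> B"
        using dense r by blast
      have "(x - r x) + c n + r x \<in> B + T"
        using n by (intro set_plus_intro) (simp_all add: T_def)
      then show "(B + T) \<inter> V \<noteq> {}"
        using m[OF n(1)] S(1) by blast
    qed
    then show ?thesis
      by blast
  qed
  moreover have "(card_of A, natLeq) \<in> ordIso"
  proof -
    have "bij_betw (to_nat_on A) A UNIV"
      using countable_subset[OF AH H(2)] \<open>infinite A\<close> by (rule to_nat_on_infinite)
    then have "(card_of A, card_of (UNIV :: nat set)) \<in> ordIso"
      by (rule card_of_ordIsoI)
    then show ?thesis
      by (rule ordIso_transitive[OF _ card_of_nat])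
  qed
  moreover have "disjoint_family_on (\<lambda>a. a +o (B + T)) A"
    unfolding disjoint_family_on_def
  proof (intro ballI impI)
    fix x y assume xy: "x \<in> A" "y \<in> A" "x \<noteq> y"
    have "x = y" if "z \<in> x +o (B + T)" "z \<in> y +o (B + T)" for z
    proof -
      obtain b t where b: "b \<in> B" "t \<in> T" "z = x + (b + t)"
        using \<open>z \<in> x +o (B + T)\<close> by (auto simp: elt_set_plus_def elim!: set_plus_elim)
      obtain b' t' where b': "b' \<in> B" "t' \<in> T" "z = y + (b' + t')"
        using \<open>z \<in> y +o (B + T)\<close> by (auto simp: elt_set_plus_def elim!: set_plus_elim)
      have "x + b \<in> H" "y + b' \<in> H"
        using set_plus_intro[OF xy(1) b(1)] set_plus_intro[OF xy(2) b'(1)] AB by simp_all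
      then have "r z = t" "r z = t'"
        using b b' r_eq[of "x + b" t] r_eq[of "y + b'" t'] rT by (simp_all add: add.assoc)
      then have "x + b = y + b'"
        using b b' by (simp flip: add.assoc)
      then show ?thesis
        using directD[OF dir] xy b b' by blast
    qed
    then show "(x +o (B + T)) \<inter> (y +o (B + T)) = {}"
      using xy by blast
  qed
  moreover have "A + (B + T) = UNIV"
  proof -
    have "x \<in> H + T" for x
      using set_plus_intro[OF r[of x], of "r x" T] by (simp add: T_def)
    then show ?thesis
      using AB by (auto simp flip: add.assoc)
  qed
  ultimately show ?thesis
    unfolding box_resolvable_def by blast
qed

end
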